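(* Let $\alpha\vDash n$, $\beta\vDash m$ be compositions with $\beta\subseteq\alpha$. Then $\mathcal{W}_{\alpha/\beta}$ is a cyclic $H_{n-m}(0)$-module generated by the element $S^{row}_{\alpha/\beta}$. The same statement holds for the module $\overline{\mathcal{A}}_{\alpha/\beta}$ defined by the $\overline{\mathcal{A}}^*$-action on $\mathrm{SIT}(\alpha/\beta)$.
   Context: Compositions and tableaux. A composition $\alpha=(\alpha_1,\dots,\alpha_k)\vDash n$ is a finite sequence of positive integers with sum $n=|\alpha|$; $\ell(\alpha)=k$; $\emptyset$ is the empty composition of $0$. The diagram of $\alpha$ is the left-justified array of cells with $\alpha_i$ cells in row $i$, rows numbered from bottom to top. $\beta\subseteq\alpha$ means $\ell(\beta)\le\ell(\alpha)$ and $\beta_j\le\alpha_j$ for all $1\le j\le \ell(\beta)$; the skew diagram $\alpha/\beta$ is the set of cells of the diagram of $\alpha$ not in that of $\beta$, where $\beta$ is placed in the bottom-left corner of $\alpha$. $\mathrm{SIT}(\alpha/\beta)$ is the set of bijective fillings of the cells of $\alpha/\beta$ with $1,\dots,|\alpha|-|\beta|$ such that the entries in the cells of the leftmost column of $\alpha$ that are not in $\beta$ increase from bottom to top, and all rows increase from left to right. $S^{row}_{\alpha/\beta}\in\mathrm{SIT}(\alpha/\beta)$ is the row superstandard tableau: its rows are filled left to right, bottom to top, beginning with the bottom row and moving up, with $1,2,\dots,n-m$ in consecutive order. $H_N(0)$ is the $\mathbb{C}$-algebra with generators $\pi_1,\dots,\pi_{N-1}$ and relations $\pi_i^2=\pi_i$,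 $\pi_i\pi_{i+1}\pi_i=\pi_{i+1}\pi_i\pi_{i+1}$, $\pi_i\pi_j=\pi_j\pi_i$ for $|i-j|\ge2$ (and $H_0(0)=H_1(0)=\mathbb{C}$). Let $s_i$ switch the entries $i,i+1$ of a tableau. Let $\mathrm{Des}_{\mathfrak{S}^*}(T)$ be the set of $i$ such that $i+1$ is in a row strictly above $i$ in $T$, and $\mathrm{Des}_{\overline{\mathcal{A}}^*}(T)$ the set of $i$ such that $i+1$ is in a row weakly above $i$ in $T$. For $a\in\{\mathfrak{S}^*,\overline{\mathcal{A}}^*\}$ the $a$-action of $H_{n-m}(0)$ on the complex vector space with basis $\mathrm{SIT}(\alpha/\beta)$ is: $\pi_i^a(T)=T$ if $i\notin\mathrm{Des}_a(T)$; $\pi_i^a(T)=s_i(T)$ if $i\in\mathrm{Des}_a(T)$ and $s_i(T)\in\mathrm{SIT}(\alpha/\beta)$; $\pi_i^a(T)=0$ otherwise. The resulting modules are $\mathcal{W}_{\alpha/\beta}$ (for $a=\mathfrak{S}^*$) and $\overline{\mathcal{A}}_{\alpha/\beta}$ (for $a=\overline{\mathcal{A}}^*$). *)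

theory Defs
  imports
    Complex_Main
    "HOL-Library.Poly_Mapping"
    "HOL-Combinatorics.Transposition"
    "HOL-Algebra.Module"
    "HOL-Algebra.QuotRing"
begin

definition composition :: "nat list \<Rightarrow> nat \<Rightarrow> bool" where
  "composition \<alpha> n \<longleftrightarrow> (\<forall>a\<in>set \<alpha>. 0 < a) \<and> sum_list \<alpha> = n"

definition contained :: "nat list \<Rightarrow> nat list \<Rightarrow> bool" where
  "contained \<beta> \<alpha> \<longleftrightarrow> length \<beta> \<le> length \<alpha> \<and> (\<forall>j<length \<beta>. \<beta> ! j \<le> \<alpha> ! j)"

text \<open>A cell is a pair (row, column). Both coordinates are counted from 0, rows from bottom to
  top and columns from left to right.\<close>

type_synonym cell = "nat \<times> nat"

definition diagram :: "nat list \<Rightarrow> cell set" where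
  "diagram \<alpha> = {(r, c). r < length \<alpha> \<and> c < \<alpha> ! r}"

definition skew :: "nat list \<Rightarrow> nat list \<Rightarrow> cell set" where
  "skew \<alpha> \<beta> = diagram \<alpha> - diagram \<beta>"

text \<open>Fillings are total functions on cells; the value 0 outside the diagram makes them unique.\<close>

type_synonym tableau = "cell \<Rightarrow> nat"

definition SIT :: "nat list \<Rightarrow> nat list \<Rightarrow> tableau set" where
  "SIT \<alpha> \<beta> = {T.
     bij_betw T (skew \<alpha> \<beta>) {1..sum_list \<alpha> - sum_list \<beta>} \<and>
     (\<forall>x. x \<notin> skew \<alpha> \<beta> \<longrightarrow> T x = 0) \<and>
     (\<forall>r r'. (r, 0) \<in> skew \<alpha> \<beta> \<and> (r', 0) \<in> skew \<alpha> \<beta> \<and> r < r' \<longrightarrow> T (r, 0) < T (r', 0)) \<and>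
     (\<forall>r c c'. (r, c) \<in> skew \<alpha> \<beta> \<and> (r, c') \<in> skew \<alpha> \<beta> \<and> c < c' \<longrightarrow> T (r, c) < T (r, c'))}"

text \<open>The entry of a cell is its position in the reading order of the rows, left to right and
  bottom to top.\<close>

definition row_superstandard :: "nat list \<Rightarrow> nat list \<Rightarrow> tableau" where
  "row_superstandard \<alpha> \<beta> = (\<lambda>(r, c).
     if (r, c) \<in> skew \<alpha> \<beta>
     then card {(r', c'). (r', c') \<in> skew \<alpha> \<beta> \<and> (r' < r \<or> r' = r \<and> c' \<le> c)}
     else 0)"

definition swap_entries :: "nat \<Rightarrow> tableau \<Rightarrow> tableau" where
  "swap_entries i T = transpose i (Suc i) \<circ> T"

definition Des_S :: "nat list \<Rightarrow> nat list \<Rightarrow> tableau \<Rightarrow> nat set" where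
  "Des_S \<alpha> \<beta> T =
     {i. \<exists>x\<in>skew \<alpha> \<beta>. \<exists>y\<in>skew \<alpha> \<beta>. T x = i \<and> T y = Suc i \<and> fst x < fst y}"

definition Des_A :: "nat list \<Rightarrow> nat list \<Rightarrow> tableau \<Rightarrow> nat set" where
  "Des_A \<alpha> \<beta> T =
     {i. \<exists>x\<in>skew \<alpha> \<beta>. \<exists>y\<in>skew \<alpha> \<beta>. T x = i \<and> T y = Suc i \<and> fst x \<le> fst y}"

text \<open>The word with letters \<open>i\<^sub>1, \<dots>, i\<^sub>k\<close> stands for the product of the generators with these
  indices. Concatenation makes words a monoid, written additively so that the product of
  \<^typ>\<open>'k \<Rightarrow>\<^sub>0 'c\<close> (convolution along the addition of the keys) is that of the free algebra.\<close>

datatype word = Word (letters: "nat list")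

instantiation word :: monoid_add
begin

definition "0 = Word []"

definition "u + v = Word (letters u @ letters v)"

instance
  by standard (simp_all add: zero_word_def plus_word_def)

end

type_synonym free_elem = "word \<Rightarrow>\<^sub>0 complex"

definition free_algebra :: "nat \<Rightarrow> free_elem ring" where
  "free_algebra N =
     \<lparr>carrier = {f. \<forall>w\<in>Poly_Mapping.keys f. set (letters w) \<subseteq> {1..<N}},
      mult = (*), one = 1, zero = 0, add = (+)\<rparr>"

definition free_gen :: "nat \<Rightarrow> free_elem" where
  "free_gen i = Poly_Mapping.single (Word [i]) 1"

definition hecke_relators :: "nat \<Rightarrow> free_elem set" where
  "hecke_relators N =
     {free_gen i * free_gen i - free_gen i | i. i \<in> {1..<N}} \<union>
     {free_gen i * free_gen (Suc i) * free_gen i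
        - free_gen (Suc i) * free_gen i * free_gen (Suc i) | i. i \<in> {1..<N} \<and> Suc i \<in> {1..<N}} \<union>
     {free_gen i * free_gen j - free_gen j * free_gen i | i j.
        i \<in> {1..<N} \<and> j \<in> {1..<N} \<and> (i + 2 \<le> j \<or> j + 2 \<le> i)}"

definition hecke_ideal :: "nat \<Rightarrow> free_elem set" where
  "hecke_ideal N = genideal (free_algebra N) (hecke_relators N)"

definition hecke_algebra :: "nat \<Rightarrow> free_elem set ring" where
  "hecke_algebra N = free_algebra N Quot hecke_ideal N"

definition hecke_class :: "nat \<Rightarrow> free_elem \<Rightarrow> free_elem set" where
  "hecke_class N f = hecke_ideal N +>\<^bsub>free_algebra N\<^esub> f"

definition hecke_gen :: "nat \<Rightarrow> nat \<Rightarrow> free_elem set" where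
  "hecke_gen N i = hecke_class N (free_gen i)"

definition hecke_scalar :: "nat \<Rightarrow> complex \<Rightarrow> free_elem set" where
  "hecke_scalar N c = hecke_class N (Poly_Mapping.single 0 c)"

text \<open>The axioms of the library's locale \<^locale>\<open>module\<close>, which is restricted to commutative
  rings, over an arbitrary ring.\<close>

locale left_module = R?: ring R + M?: abelian_group M for R (structure) and M (structure) +
  assumes smult_closed:
      "a \<in> carrier R \<Longrightarrow> x \<in> carrier M \<Longrightarrow> a \<odot>\<^bsub>M\<^esub> x \<in> carrier M"
    and smult_l_distr:
      "a \<in> carrier R \<Longrightarrow> b \<in> carrier R \<Longrightarrow> x \<in> carrier M \<Longrightarrow>
       (a \<oplus> b) \<odot>\<^bsub>M\<^esub> x = a \<odot>\<^bsub>M\<^esub> x \<oplus>\<^bsub>M\<^esub> b \<odot>\<^bsub>M\<^esub> x"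
    and smult_r_distr:
      "a \<in> carrier R \<Longrightarrow> x \<in> carrier M \<Longrightarrow> y \<in> carrier M \<Longrightarrow>
       a \<odot>\<^bsub>M\<^esub> (x \<oplus>\<^bsub>M\<^esub> y) = a \<odot>\<^bsub>M\<^esub> x \<oplus>\<^bsub>M\<^esub> a \<odot>\<^bsub>M\<^esub> y"
    and smult_assoc1:
      "a \<in> carrier R \<Longrightarrow> b \<in> carrier R \<Longrightarrow> x \<in> carrier M \<Longrightarrow>
       (a \<otimes> b) \<odot>\<^bsub>M\<^esub> x = a \<odot>\<^bsub>M\<^esub> (b \<odot>\<^bsub>M\<^esub> x)"
    and smult_one:
      "x \<in> carrier M \<Longrightarrow> \<one> \<odot>\<^bsub>M\<^esub> x = x"

definition cyclic_module ::
    "('a, 'r) ring_scheme \<Rightarrow> ('a, 'b, 's) module_scheme \<Rightarrow> 'b \<Rightarrow> bool" where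
  "cyclic_module R M g \<longleftrightarrow>
     left_module R M \<and> g \<in> carrier M \<and> carrier M = {h \<odot>\<^bsub>M\<^esub> g | h. h \<in> carrier R}"

type_synonym tableau_vec = "tableau \<Rightarrow>\<^sub>0 complex"

definition basis_vec :: "tableau \<Rightarrow> tableau_vec" where
  "basis_vec T = Poly_Mapping.single T 1"

definition scale :: "complex \<Rightarrow> tableau_vec \<Rightarrow> tableau_vec" where
  "scale c v = Poly_Mapping.map ((*) c) v"

definition linear_ext :: "(tableau \<Rightarrow> tableau_vec) \<Rightarrow> tableau_vec \<Rightarrow> tableau_vec" where
  "linear_ext p v = (\<Sum>T\<in>Poly_Mapping.keys v. scale (Poly_Mapping.lookup v T) (p T))"

definition hecke_pi ::
    "(tableau \<Rightarrow> nat set) \<Rightarrow> tableau set \<Rightarrow> nat \<Rightarrow> tableau \<Rightarrow> tableau_vec" where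
  "hecke_pi Des B i T =
     (if i \<notin> Des T then basis_vec T
      else if swap_entries i T \<in> B then basis_vec (swap_entries i T)
      else 0)"

text \<open>The leftmost letter of a word is applied last, as for a left module.\<close>

definition free_action ::
    "(nat \<Rightarrow> tableau \<Rightarrow> tableau_vec) \<Rightarrow> free_elem \<Rightarrow> tableau_vec \<Rightarrow> tableau_vec" where
  "free_action p f v =
     (\<Sum>w\<in>Poly_Mapping.keys f.
        scale (Poly_Mapping.lookup f w) (foldr (\<lambda>i. linear_ext (p i)) (letters w) v))"

text \<open>An element of the 0-Hecke algebra is a coset of the free algebra; it acts by the common
  action of its representatives. That there is one, i.e. that the operators satisfy the defining
  relations, is not built into the definition: \<open>is_hecke_action\<close> below says that the resulting
  product has the prescribed values on the generators.

  The fields \<open>mult\<close> and \<open>one\<close> of a module record carry no meaning.\<close>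

definition hecke_module ::
    "tableau set \<Rightarrow> (nat \<Rightarrow> tableau \<Rightarrow> tableau_vec)
     \<Rightarrow> (free_elem set, tableau_vec) module" where
  "hecke_module B p =
     \<lparr>carrier = {v. Poly_Mapping.keys v \<subseteq> B},
      mult = undefined, one = undefined, zero = 0, add = (+),
      smult = (\<lambda>h v. THE u. \<forall>f\<in>h. free_action p f v = u)\<rparr>"

definition is_hecke_action ::
    "nat \<Rightarrow> tableau set \<Rightarrow> (nat \<Rightarrow> tableau \<Rightarrow> tableau_vec)
     \<Rightarrow> (free_elem set, tableau_vec) module \<Rightarrow> bool" where
  "is_hecke_action N B p M \<longleftrightarrow>
     (\<forall>c. \<forall>v\<in>carrier M. hecke_scalar N c \<odot>\<^bsub>M\<^esub> v = scale c v) \<and>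
     (\<forall>i\<in>{1..<N}. \<forall>T\<in>B. hecke_gen N i \<odot>\<^bsub>M\<^esub> basis_vec T = p i T)"

definition pi_S :: "nat list \<Rightarrow> nat list \<Rightarrow> nat \<Rightarrow> tableau \<Rightarrow> tableau_vec" where
  "pi_S \<alpha> \<beta> = hecke_pi (Des_S \<alpha> \<beta>) (SIT \<alpha> \<beta>)"

definition pi_A :: "nat list \<Rightarrow> nat list \<Rightarrow> nat \<Rightarrow> tableau \<Rightarrow> tableau_vec" where
  "pi_A \<alpha> \<beta> = hecke_pi (Des_A \<alpha> \<beta>) (SIT \<alpha> \<beta>)"

definition W_module :: "nat list \<Rightarrow> nat list \<Rightarrow> (free_elem set, tableau_vec) module" where
  "W_module \<alpha> \<beta> = hecke_module (SIT \<alpha> \<beta>) (pi_S \<alpha> \<beta>)"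

definition A_module :: "nat list \<Rightarrow> nat list \<Rightarrow> (free_elem set, tableau_vec) module" where
  "A_module \<alpha> \<beta> = hecke_module (SIT \<alpha> \<beta>) (pi_A \<alpha> \<beta>)"

end

theory Submission
  imports Defs
begin

text \<open>Read a tableau as the list of its cells, in the order of their entries. The operator
  \<open>\<pi>\<^sub>i\<close> compares the cells with entries \<open>i\<close> and \<open>Suc i\<close> in a fixed total order of the cells. It
  leaves them if they are decreasing; otherwise it exchanges them, or gives 0 if the two cells are
  blocked, that is, lie in the same row or both in the first column. Being blocked does not depend
  on the entries.
  So the \<open>\<pi>\<^sub>i\<close> are bubble sort operators that may fail, and the 0-Hecke relations hold because
  the pairs of cells that are compared do not depend on the order of the steps.

  If no entry \<open>Suc i\<close> is in a row strictly below \<open>i\<close>, the tableau is row superstandard.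
  Otherwise \<open>\<pi>\<^sub>i\<close> maps the tableau with \<open>i\<close> and \<open>Suc i\<close> exchanged to the given one, and the
  exchanged one is closer to being row superstandard. For both actions this reaches every basis
  vector from the row superstandard one.\<close>

section \<open>Linear extensions and the free algebra\<close>

text \<open>Reduces identities that are additive in the argument to monomials. An update at a fresh
  key is the addition of a monomial at that key.\<close>

lemma poly_mapping_single_add_induct [case_names zero single add]:
  fixes f :: "'a \<Rightarrow>\<^sub>0 'b::comm_monoid_add"
  assumes "P 0" "\<And>a c. P (Poly_Mapping.single a c)" "\<And>f g. P f \<Longrightarrow> P g \<Longrightarrow> P (f + g)"
  shows "P f"
proof (induction f rule: Poly_Mapping.update_induct)
  case const
  show ?case by (rule assms)
next
  case (update f a b)
  have "Poly_Mapping.update a b f = f + Poly_Mapping.single a b"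
    using update(1)
    by (intro poly_mapping_eqI)
      (auto simp: lookup_update lookup_add lookup_single when_def in_keys_iff)
  then show ?case using assms update by simp
qed

lemma lookup_scale [simp]: "Poly_Mapping.lookup (scale c v) T = c * Poly_Mapping.lookup v T"
  unfolding scale_def by transfer (simp add: when_def)

lemma scale_zero_left [simp]: "scale 0 v = 0"
  and scale_zero_right [simp]: "scale c 0 = 0"
  and scale_one [simp]: "scale 1 v = v"
  and scale_scale [simp]: "scale c (scale d v) = scale (c * d) v"
  and scale_add_right: "scale c (u + v) = scale c u + scale c v"
  and scale_add_left: "scale (c + d) v = scale c v + scale d v"
  by (auto intro!: poly_mapping_eqI simp: lookup_add algebra_simps)

lemma scale_sum: "scale c (sum g A) = (\<Sum>a\<in>A. scale c (g a))"
  by (induction A rule: infinite_finite_induct) (simp_all add: scale_add_right)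

lemma keys_scale: "Poly_Mapping.keys (scale c v) \<subseteq> Poly_Mapping.keys v"
  by (auto simp: in_keys_iff)

text \<open>Both \<^const>\<open>linear_ext\<close> and, for a fixed vector, \<^const>\<open>free_action\<close> are of this form.\<close>

definition lin_comb :: "('a \<Rightarrow> tableau_vec) \<Rightarrow> ('a \<Rightarrow>\<^sub>0 complex) \<Rightarrow> tableau_vec" where
  "lin_comb \<phi> f = (\<Sum>a\<in>Poly_Mapping.keys f. scale (Poly_Mapping.lookup f a) (\<phi> a))"

text \<open>Keys outside the support have coefficient 0. A common finite index set makes the sums
  for \<open>f\<close>, \<open>g\<close> and \<open>f + g\<close> comparable although their supports
  differ.\<close>

lemma lin_comb_superset:
  assumes "finite A" "Poly_Mapping.keys f \<subseteq> A"
  shows "lin_comb \<phi> f = (\<Sum>a\<in>A. scale (Poly_Mapping.lookup f a) (\<phi> a))"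
  unfolding lin_comb_def using assms
  by (intro sum.mono_neutral_left) (auto simp: in_keys_iff)

lemma lin_comb_zero [simp]: "lin_comb \<phi> 0 = 0"
  by (simp add: lin_comb_def)

lemma lin_comb_single [simp]: "lin_comb \<phi> (Poly_Mapping.single a c) = scale c (\<phi> a)"
  by (simp add: lin_comb_def)

lemma lin_comb_add: "lin_comb \<phi> (f + g) = lin_comb \<phi> f + lin_comb \<phi> g"
proof -
  let ?A = "Poly_Mapping.keys f \<union> Poly_Mapping.keys g"
  have "lin_comb \<phi> (f + g) = (\<Sum>a\<in>?A. scale (Poly_Mapping.lookup (f + g) a) (\<phi> a))"
    by (intro lin_comb_superset keys_add) simp
  also have "\<dots> = (\<Sum>a\<in>?A. scale (Poly_Mapping.lookup f a) (\<phi> a))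
      + (\<Sum>a\<in>?A. scale (Poly_Mapping.lookup g a) (\<phi> a))"
    by (simp add: lookup_add scale_add_left sum.distrib)
  also have "\<dots> = lin_comb \<phi> f + lin_comb \<phi> g"
    using lin_comb_superset[of ?A f \<phi>] lin_comb_superset[of ?A g \<phi>] by simp
  finally show ?thesis .
qed

lemma lin_comb_diff: "lin_comb \<phi> (f - g) = lin_comb \<phi> f - lin_comb \<phi> g"
  using lin_comb_add[of \<phi> "f - g" g] by simp

lemma lin_comb_scale: "lin_comb \<phi> (scale c v) = scale c (lin_comb \<phi> v)"
  by (subst lin_comb_superset[OF _ keys_scale]) (simp_all add: lin_comb_def scale_sum)

lemma lin_comb_add_fun: "lin_comb (\<lambda>a. \<phi> a + \<psi> a) f = lin_comb \<phi> f + lin_comb \<psi> f"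
  by (simp add: lin_comb_def scale_add_right sum.distrib)

lemma lin_comb_scale_fun: "lin_comb (\<lambda>a. scale c (\<phi> a)) f = scale c (lin_comb \<phi> f)"
  by (simp add: lin_comb_def scale_sum mult.commute)

lemma lin_comb_cong:
  "(\<And>a. a \<in> Poly_Mapping.keys f \<Longrightarrow> \<phi> a = \<psi> a) \<Longrightarrow> lin_comb \<phi> f = lin_comb \<psi> f"
  by (simp add: lin_comb_def)

lemma keys_lin_comb:
  assumes "\<And>a. a \<in> Poly_Mapping.keys f \<Longrightarrow> Poly_Mapping.keys (\<phi> a) \<subseteq> B"
  shows "Poly_Mapping.keys (lin_comb \<phi> f) \<subseteq> B"
proof -
  have "Poly_Mapping.keys (lin_comb \<phi> f)
      \<subseteq> (\<Union>a\<in>Poly_Mapping.keys f. Poly_Mapping.keys (scale (Poly_Mapping.lookup f a) (\<phi> a)))"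
    unfolding lin_comb_def by (rule keys_sum)
  also have "\<dots> \<subseteq> B"
    using keys_scale assms by (intro UN_least) (meson subset_trans)
  finally show ?thesis .
qed

lemma lin_comb_basis_vec [simp]: "lin_comb basis_vec v = v"
proof (induction v rule: poly_mapping_single_add_induct)
  case (single T c)
  show ?case by (auto intro!: poly_mapping_eqI simp: basis_vec_def lookup_single when_def)
qed (simp_all add: lin_comb_add)

section \<open>Linear maps and their values on basis vectors\<close>

definition vec_linear :: "(tableau_vec \<Rightarrow> tableau_vec) \<Rightarrow> bool" where
  "vec_linear g \<longleftrightarrow> (\<forall>u v. g (u + v) = g u + g v) \<and> (\<forall>c v. g (scale c v) = scale c (g v))"

lemma vec_linear_lin_comb:
  assumes "vec_linear g"
  shows "g (lin_comb \<phi> f) = lin_comb (\<lambda>a. g (\<phi> a)) f"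
proof (induction f rule: poly_mapping_single_add_induct)
  case zero
  have "g (scale 0 0) = scale 0 (g 0)" using assms unfolding vec_linear_def by blast
  then show ?case by simp
next
  case (single a c)
  then show ?case using assms by (simp add: vec_linear_def)
next
  case (add f g)
  then show ?case using assms by (simp add: vec_linear_def lin_comb_add)
qed

text \<open>Every \<open>v\<close> equals \<open>lin_comb basis_vec v\<close>, and a linear map
  passes through \<open>lin_comb\<close>. The 0-Hecke relations therefore need checking only on
  single tableaux.\<close>

lemma vec_linear_eqI:
  assumes "vec_linear g" "vec_linear h" "Poly_Mapping.keys v \<subseteq> B"
    and "\<And>T. T \<in> B \<Longrightarrow> g (basis_vec T) = h (basis_vec T)"
  shows "g v = h v"
proof -
  have "g (lin_comb basis_vec v) = h (lin_comb basis_vec v)"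
    unfolding vec_linear_lin_comb[OF assms(1)] vec_linear_lin_comb[OF assms(2)]
    using assms(3,4) by (intro lin_comb_cong) auto
  then show ?thesis by simp
qed

lemma vec_linear_comp: "vec_linear g \<Longrightarrow> vec_linear h \<Longrightarrow> vec_linear (\<lambda>v. g (h v))"
  by (simp add: vec_linear_def)

lemma linear_ext_eq_lin_comb: "linear_ext p = lin_comb p"
  by (auto simp: linear_ext_def lin_comb_def)

lemma vec_linear_linear_ext: "vec_linear (linear_ext p)"
  by (simp add: vec_linear_def linear_ext_eq_lin_comb lin_comb_add lin_comb_scale)

lemma linear_ext_basis_vec [simp]: "linear_ext p (basis_vec T) = p T"
  by (simp add: linear_ext_eq_lin_comb basis_vec_def)

lemma linear_ext_zero [simp]: "linear_ext p 0 = 0"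
  by (simp add: linear_ext_eq_lin_comb)

section \<open>Words and the action of the free algebra\<close>

lemma letters_zero [simp]: "letters 0 = []"
  by (simp add: zero_word_def)

lemma letters_add [simp]: "letters (u + w) = letters u @ letters w"
  by (simp add: plus_word_def)

abbreviation word_action ::
    "(nat \<Rightarrow> tableau \<Rightarrow> tableau_vec) \<Rightarrow> nat list \<Rightarrow> tableau_vec \<Rightarrow> tableau_vec" where
  "word_action p is \<equiv> foldr (\<lambda>i. linear_ext (p i)) is"

lemma vec_linear_word_action: "vec_linear (word_action p is)"
proof (induction "is")
  case Nil
  show ?case by (simp add: vec_linear_def)
next
  case (Cons i "is")
  show ?case using vec_linear_comp[OF vec_linear_linear_ext Cons] by (simp add: comp_def)
qed

lemma free_action_eq_lin_comb: "free_action p f v = lin_comb (\<lambda>w. word_action p (letters w) v) f"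
  by (simp add: free_action_def lin_comb_def)

lemma vec_linear_free_action: "vec_linear (free_action p f)"
  using vec_linear_word_action[of p]
  by (simp add: vec_linear_def free_action_eq_lin_comb lin_comb_add_fun lin_comb_scale_fun)

lemma free_action_add_vec: "free_action p f (u + v) = free_action p f u + free_action p f v"
  using vec_linear_free_action[of p f] by (simp add: vec_linear_def)

lemma free_action_zero_vec [simp]: "free_action p f 0 = 0"
  using free_action_add_vec[of p f 0 0] by simp

lemma free_action_add: "free_action p (f + g) v = free_action p f v + free_action p g v"
  and free_action_diff: "free_action p (f - g) v = free_action p f v - free_action p g v"
  and free_action_zero [simp]: "free_action p 0 v = 0"
  and free_action_single:
    "free_action p (Poly_Mapping.single w c) v = scale c (word_action p (letters w) v)"
  by (simp_all add: free_action_eq_lin_comb lin_comb_add lin_comb_diff)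

lemma free_action_one [simp]: "free_action p 1 v = v"
  using free_action_single[of p 0 1 v] by simp

text \<open>Both sides are additive in \<open>f\<close> and in \<open>g\<close>, which leaves
  monomials. There the product concatenates words, and \<open>foldr\<close> over a concatenation is
  a composition in the order of a left action.\<close>

lemma free_action_mult: "free_action p (f * g) v = free_action p f (free_action p g v)"
proof (induction f rule: poly_mapping_single_add_induct)
  case (single w c)
  show ?case
  proof (induction g rule: poly_mapping_single_add_induct)
    case (single u d)
    have "word_action p (letters w) (scale d x) = scale d (word_action p (letters w) x)" for x
      using vec_linear_word_action[of p "letters w"] by (simp add: vec_linear_def)
    then show ?case by (simp add: mult_single free_action_single)
  qed (simp_all add: distrib_left free_action_add free_action_add_vec)
qed (simp_all add: distrib_right free_action_add)

lemma free_action_gen [simp]: "free_action p (free_gen i) v = linear_ext (p i) v"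
  by (simp add: free_gen_def free_action_single)

lemma carrier_free_algebra_iff:
  "f \<in> carrier (free_algebra N) \<longleftrightarrow> Poly_Mapping.keys f \<subseteq> {w. set (letters w) \<subseteq> {1..<N}}"
  unfolding free_algebra_def by auto

lemma free_algebra_closed:
  "1 \<in> carrier (free_algebra N)"
  "f \<in> carrier (free_algebra N) \<Longrightarrow> g \<in> carrier (free_algebra N) \<Longrightarrow>
    f + g \<in> carrier (free_algebra N)"
  "f \<in> carrier (free_algebra N) \<Longrightarrow> g \<in> carrier (free_algebra N) \<Longrightarrow>
    f - g \<in> carrier (free_algebra N)"
  "f \<in> carrier (free_algebra N) \<Longrightarrow> g \<in> carrier (free_algebra N) \<Longrightarrow>
    f * g \<in> carrier (free_algebra N)"
proof -
  show "1 \<in> carrier (free_algebra N)" by (simp add: free_algebra_def)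
  assume fg: "f \<in> carrier (free_algebra N)" "g \<in> carrier (free_algebra N)"
  then show "f + g \<in> carrier (free_algebra N)"
    unfolding carrier_free_algebra_iff using keys_add[of f g] by (meson Un_least subset_trans)
  show "f - g \<in> carrier (free_algebra N)"
    using fg keys_diff[of f g] unfolding carrier_free_algebra_iff
    by (meson Un_least subset_trans)
  show "f * g \<in> carrier (free_algebra N)"
    unfolding free_algebra_def partial_object.simps
  proof (intro CollectI ballI)
    fix w assume "w \<in> Poly_Mapping.keys (f * g)"
    then have "w \<in> {u + v |u v. u \<in> Poly_Mapping.keys f \<and> v \<in> Poly_Mapping.keys g}"
      using keys_mult[of f g] by blast
    then obtain u v where "w = u + v" "u \<in> Poly_Mapping.keys f" "v \<in> Poly_Mapping.keys g"
      by blast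
    then show "set (letters w) \<subseteq> {1..<N}" using fg by (simp add: free_algebra_def)
  qed
qed

lemma ring_free_algebra: "ring (free_algebra N)"
proof (rule ringI)
  have ops: "f \<oplus>\<^bsub>free_algebra N\<^esub> g = f + g" "f \<otimes>\<^bsub>free_algebra N\<^esub> g = f * g"
    "\<one>\<^bsub>free_algebra N\<^esub> = 1" "\<zero>\<^bsub>free_algebra N\<^esub> = 0" for f g
    by (simp_all add: free_algebra_def)
  have zero: "0 \<in> carrier (free_algebra N)" by (simp add: free_algebra_def)
  show "abelian_group (free_algebra N)"
  proof (rule abelian_groupI)
    fix f assume "f \<in> carrier (free_algebra N)"
    then show "\<exists>g\<in>carrier (free_algebra N). g \<oplus>\<^bsub>free_algebra N\<^esub> f = \<zero>\<^bsub>free_algebra N\<^esub>"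
      using free_algebra_closed(3)[OF zero] by (intro bexI[of _ "0 - f"]) (simp_all add: ops)
  qed (simp_all add: ops free_algebra_closed zero add.assoc add.commute)
  show "Group.monoid (free_algebra N)"
    by (intro monoidI) (simp_all add: ops free_algebra_closed mult.assoc)
qed (simp_all add: free_algebra_def algebra_simps)

lemma hecke_relators_subset: "hecke_relators N \<subseteq> carrier (free_algebra N)"
proof -
  have gen: "free_gen i \<in> carrier (free_algebra N)" if "i \<in> {1..<N}" for i
    using that by (simp add: free_algebra_def free_gen_def)
  show ?thesis unfolding hecke_relators_def by (auto intro!: gen free_algebra_closed)
qed

lemma ideal_hecke_ideal: "ideal (hecke_ideal N) (free_algebra N)"
  unfolding hecke_ideal_def
  by (rule ring.genideal_ideal[OF ring_free_algebra hecke_relators_subset])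

section \<open>Modules from operators that satisfy the 0-Hecke relations\<close>

text \<open>The relations are demanded only on basis vectors from \<open>B\<close>, where the
  operators have a meaning. By \<open>closed\<close> the span of \<open>B\<close> is invariant, so
  that the relations still apply after other operators have acted.\<close>

locale hecke_rep =
  fixes N :: nat and B :: "tableau set" and p :: "nat \<Rightarrow> tableau \<Rightarrow> tableau_vec"
  assumes closed: "i \<in> {1..<N} \<Longrightarrow> T \<in> B \<Longrightarrow> Poly_Mapping.keys (p i T) \<subseteq> B"
    and idem: "i \<in> {1..<N} \<Longrightarrow> T \<in> B \<Longrightarrow> linear_ext (p i) (p i T) = p i T"
    and braid: "i \<in> {1..<N} \<Longrightarrow> Suc i \<in> {1..<N} \<Longrightarrow> T \<in> B \<Longrightarrow>
        linear_ext (p i) (linear_ext (p (Suc i)) (p i T))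
        = linear_ext (p (Suc i)) (linear_ext (p i) (p (Suc i) T))"
    and far_commute: "i \<in> {1..<N} \<Longrightarrow> j \<in> {1..<N} \<Longrightarrow> i + 2 \<le> j \<Longrightarrow> T \<in> B \<Longrightarrow>
        linear_ext (p i) (p j T) = linear_ext (p j) (p i T)"
begin

sublocale ideal "hecke_ideal N" "free_algebra N"
  by (rule ideal_hecke_ideal)

lemma linear_ext_closed:
  assumes "i \<in> {1..<N}" "Poly_Mapping.keys v \<subseteq> B"
  shows "Poly_Mapping.keys (linear_ext (p i) v) \<subseteq> B"
  unfolding linear_ext_eq_lin_comb using assms by (intro keys_lin_comb closed) auto

lemma word_action_closed:
  assumes "set is \<subseteq> {1..<N}" "Poly_Mapping.keys v \<subseteq> B"
  shows "Poly_Mapping.keys (word_action p is v) \<subseteq> B"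
  using assms(1) by (induction "is") (simp_all add: assms(2) linear_ext_closed)

lemma free_action_closed:
  assumes "f \<in> carrier (free_algebra N)" "Poly_Mapping.keys v \<subseteq> B"
  shows "Poly_Mapping.keys (free_action p f v) \<subseteq> B"
  unfolding free_action_eq_lin_comb
  using assms by (intro keys_lin_comb word_action_closed) (auto simp: free_algebra_def)

lemma relator_action:
  assumes "f \<in> hecke_relators N" "Poly_Mapping.keys v \<subseteq> B"
  shows "free_action p f v = 0"
proof -
  show ?thesis
  proof (rule vec_linear_eqI[OF vec_linear_free_action _ assms(2), where h = "\<lambda>v. 0"])
    show "vec_linear (\<lambda>v. 0)" by (simp add: vec_linear_def)
  next
    fix T assume T: "T \<in> B"
    \<comment> \<open>The relators allow both orders of the two indices, \<open>far_commute\<close>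
      only one; the equation is symmetric in \<open>i\<close> and \<open>j\<close>.\<close>
    have commute: "linear_ext (p i) (p j T) = linear_ext (p j) (p i T)"
      if "i \<in> {1..<N}" "j \<in> {1..<N}" "i + 2 \<le> j \<or> j + 2 \<le> i" for i j
      using that far_commute[of i j T] far_commute[of j i T] T by auto
    consider i where "i \<in> {1..<N}" "f = free_gen i * free_gen i - free_gen i"
      | i where "i \<in> {1..<N}" "Suc i \<in> {1..<N}"
        "f = free_gen i * free_gen (Suc i) * free_gen i
          - free_gen (Suc i) * free_gen i * free_gen (Suc i)"
      | i j where "i \<in> {1..<N}" "j \<in> {1..<N}" "i + 2 \<le> j \<or> j + 2 \<le> i"
        "f = free_gen i * free_gen j - free_gen j * free_gen i"
      using assms(1) unfolding hecke_relators_def by blast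
    then show "free_action p f (basis_vec T) = 0"
    proof cases
      case 1
      then show ?thesis using idem[of i T] T by (simp add: free_action_diff free_action_mult)
    next
      case 2
      then show ?thesis using braid[of i T] T by (simp add: free_action_diff free_action_mult)
    next
      case 3
      then show ?thesis using commute[of i j] by (simp add: free_action_diff free_action_mult)
    qed
  qed
qed

text \<open>The annihilator \<open>?K\<close> of the span of \<open>B\<close> is a two-sided ideal
  that contains the relators, so it contains the ideal they generate.\<close>

lemma hecke_ideal_action:
  assumes "f \<in> hecke_ideal N" "Poly_Mapping.keys v \<subseteq> B"
  shows "free_action p f v = 0"
proof -
  let ?K = "{f \<in> carrier (free_algebra N). \<forall>v. Poly_Mapping.keys v \<subseteq> B \<longrightarrow> free_action p f v = 0}"
  have "ideal ?K (free_algebra N)"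
  proof (rule idealI[OF ring_axioms])
    show "subgroup ?K (add_monoid (free_algebra N))"
    proof (rule add.subgroupI)
      show "?K \<subseteq> carrier (free_algebra N)" by blast
      show "?K \<noteq> {}"
        using zero_closed by (auto simp: free_algebra_def intro!: exI[of _ 0])
    next
      fix f assume f: "f \<in> ?K"
      have "\<ominus>\<^bsub>free_algebra N\<^esub> f = - f"
        using f by (intro minus_equality) (auto simp: free_algebra_def)
      with f show "\<ominus>\<^bsub>free_algebra N\<^esub> f \<in> ?K"
        using free_action_diff[of p 0 f] by (auto simp: free_algebra_def)
    next
      fix f g assume "f \<in> ?K" "g \<in> ?K"
      then show "f \<oplus>\<^bsub>free_algebra N\<^esub> g \<in> ?K"
        using a_closed[of f g] by (auto simp: free_action_add free_algebra_def)
    qed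
  next
    fix f g assume fg: "f \<in> ?K" "g \<in> carrier (free_algebra N)"
    \<comment> \<open>For \<open>f * g\<close> the factor \<open>g\<close> acts first and keeps the
      vector in the span of \<open>B\<close>, where \<open>f\<close> acts as 0; for
      \<open>g * f\<close> the factor \<open>g\<close> acts on 0.\<close>
    have "free_action p (g * f) v = 0" "free_action p (f * g) v = 0"
      if "Poly_Mapping.keys v \<subseteq> B" for v
      using fg free_action_closed[OF fg(2) that] that by (simp_all add: free_action_mult)
    moreover have "g * f \<in> carrier (free_algebra N)" "f * g \<in> carrier (free_algebra N)"
      using fg by (simp_all add: free_algebra_closed)
    moreover have "g \<otimes>\<^bsub>free_algebra N\<^esub> f = g * f" "f \<otimes>\<^bsub>free_algebra N\<^esub> g = f * g"
      by (simp_all add: free_algebra_def)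
    ultimately show "g \<otimes>\<^bsub>free_algebra N\<^esub> f \<in> ?K" "f \<otimes>\<^bsub>free_algebra N\<^esub> g \<in> ?K"
      by simp_all
  qed
  moreover have "hecke_relators N \<subseteq> ?K"
    using hecke_relators_subset relator_action by blast
  ultimately have "hecke_ideal N \<subseteq> ?K"
    unfolding hecke_ideal_def by (rule genideal_minimal)
  with assms show ?thesis by blast
qed

text \<open>The action of a coset is well defined: two representatives differ by an element of the
  ideal, which acts as 0. Later computations with cosets go through this equation.\<close>

lemma hecke_class_smult:
  assumes "f \<in> carrier (free_algebra N)" "Poly_Mapping.keys v \<subseteq> B"
  shows "hecke_class N f \<odot>\<^bsub>hecke_module B p\<^esub> v = free_action p f v"
proof -
  have eq: "free_action p g v = free_action p f v" if g: "g \<in> hecke_class N f" for g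
  proof -
    obtain h where "h \<in> hecke_ideal N" "g = h + f"
      using g by (auto simp: hecke_class_def a_r_coset_def' free_algebra_def)
    then show ?thesis using assms by (simp add: free_action_add hecke_ideal_action)
  qed
  \<comment> \<open>The description by \<open>THE\<close> needs the coset to be nonempty: its member
    \<open>f\<close> forces the value \<open>u\<close>.\<close>
  have f: "f \<in> hecke_class N f"
    unfolding hecke_class_def by (rule a_rcos_self[OF assms(1)])
  have "(THE u. \<forall>g\<in>hecke_class N f. free_action p g v = u) = free_action p f v"
  proof (rule the_equality)
    show "\<forall>g\<in>hecke_class N f. free_action p g v = free_action p f v" using eq by blast
  next
    fix u assume "\<forall>g\<in>hecke_class N f. free_action p g v = u"
    from bspec[OF this f] show "u = free_action p f v" by (rule sym)
  qed
  then show ?thesis by (simp add: hecke_module_def)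
qed

lemma hecke_algebra_simps:
  "carrier (hecke_algebra N) = hecke_class N ` carrier (free_algebra N)"
  "\<one>\<^bsub>hecke_algebra N\<^esub> = hecke_class N 1"
  "f \<in> carrier (free_algebra N) \<Longrightarrow> g \<in> carrier (free_algebra N) \<Longrightarrow>
    hecke_class N f \<oplus>\<^bsub>hecke_algebra N\<^esub> hecke_class N g = hecke_class N (f + g)"
  "f \<in> carrier (free_algebra N) \<Longrightarrow> g \<in> carrier (free_algebra N) \<Longrightarrow>
    hecke_class N f \<otimes>\<^bsub>hecke_algebra N\<^esub> hecke_class N g = hecke_class N (f * g)"
proof -
  show "carrier (hecke_algebra N) = hecke_class N ` carrier (free_algebra N)"
    by (auto simp: hecke_algebra_def FactRing_def A_RCOSETS_def' hecke_class_def)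
  have "\<one>\<^bsub>free_algebra N\<^esub> = 1" by (simp add: free_algebra_def)
  then show "\<one>\<^bsub>hecke_algebra N\<^esub> = hecke_class N 1"
    by (simp add: hecke_algebra_def FactRing_def hecke_class_def)
next
  assume fg: "f \<in> carrier (free_algebra N)" "g \<in> carrier (free_algebra N)"
  have "f \<oplus>\<^bsub>free_algebra N\<^esub> g = f + g" "f \<otimes>\<^bsub>free_algebra N\<^esub> g = f * g"
    by (simp_all add: free_algebra_def)
  with a_rcos_sum[OF fg] rcoset_mult_add[OF fg]
  show "hecke_class N f \<oplus>\<^bsub>hecke_algebra N\<^esub> hecke_class N g = hecke_class N (f + g)"
    "hecke_class N f \<otimes>\<^bsub>hecke_algebra N\<^esub> hecke_class N g = hecke_class N (f * g)"
    by (simp_all add: hecke_algebra_def FactRing_def hecke_class_def)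
qed

lemma keys_add_subset:
  "Poly_Mapping.keys u \<subseteq> B \<Longrightarrow> Poly_Mapping.keys v \<subseteq> B \<Longrightarrow>
    Poly_Mapping.keys (u + v :: tableau_vec) \<subseteq> B"
  using keys_add[of u v] by blast

text \<open>Each module axiom is an identity for \<open>free_action\<close> on chosen
  representatives, carried over to cosets by \<open>hecke_class_smult\<close>.\<close>

lemma left_module_hecke_module: "left_module (hecke_algebra N) (hecke_module B p)"
proof -
  have M: "carrier (hecke_module B p) = {v. Poly_Mapping.keys v \<subseteq> B}"
    "u \<oplus>\<^bsub>hecke_module B p\<^esub> v = u + v" "\<zero>\<^bsub>hecke_module B p\<^esub> = 0" for u v
    by (simp_all add: hecke_module_def)
  have "abelian_group (hecke_module B p)"
  proof (rule abelian_groupI)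
    fix v assume "v \<in> carrier (hecke_module B p)"
    then show "\<exists>u\<in>carrier (hecke_module B p). u \<oplus>\<^bsub>hecke_module B p\<^esub> v = \<zero>\<^bsub>hecke_module B p\<^esub>"
      by (intro bexI[of _ "- v"]) (simp_all add: M)
  qed (use keys_add_subset in \<open>auto simp: M add.assoc add.commute\<close>)
  moreover have "ring (hecke_algebra N)"
    unfolding hecke_algebra_def by (rule quotient_is_ring)
  moreover have "left_module_axioms (hecke_algebra N) (hecke_module B p)"
  proof
    fix v assume v: "v \<in> carrier (hecke_module B p)"
    then show "\<one>\<^bsub>hecke_algebra N\<^esub> \<odot>\<^bsub>hecke_module B p\<^esub> v = v"
      by (simp add: M hecke_algebra_simps(2) hecke_class_smult free_algebra_closed)
    fix a assume "a \<in> carrier (hecke_algebra N)"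
    then obtain f where f: "f \<in> carrier (free_algebra N)" "a = hecke_class N f"
      by (auto simp only: hecke_algebra_simps(1))
    show "a \<odot>\<^bsub>hecke_module B p\<^esub> v \<in> carrier (hecke_module B p)"
      using f v by (simp add: M hecke_class_smult free_action_closed)
    show "a \<odot>\<^bsub>hecke_module B p\<^esub> (v \<oplus>\<^bsub>hecke_module B p\<^esub> u)
        = a \<odot>\<^bsub>hecke_module B p\<^esub> v \<oplus>\<^bsub>hecke_module B p\<^esub> a \<odot>\<^bsub>hecke_module B p\<^esub> u"
      if "u \<in> carrier (hecke_module B p)" for u
      using f v that by (simp add: M hecke_class_smult keys_add_subset free_action_add_vec)
    fix b assume "b \<in> carrier (hecke_algebra N)"
    then obtain g where g: "g \<in> carrier (free_algebra N)" "b = hecke_class N g"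
      by (auto simp only: hecke_algebra_simps(1))
    show "(a \<oplus>\<^bsub>hecke_algebra N\<^esub> b) \<odot>\<^bsub>hecke_module B p\<^esub> v
        = a \<odot>\<^bsub>hecke_module B p\<^esub> v \<oplus>\<^bsub>hecke_module B p\<^esub> b \<odot>\<^bsub>hecke_module B p\<^esub> v"
      using f g v
      by (simp add: M hecke_algebra_simps(3) hecke_class_smult free_algebra_closed free_action_add)
    show "(a \<otimes>\<^bsub>hecke_algebra N\<^esub> b) \<odot>\<^bsub>hecke_module B p\<^esub> v
        = a \<odot>\<^bsub>hecke_module B p\<^esub> (b \<odot>\<^bsub>hecke_module B p\<^esub> v)"
      using f g v
      by (simp add: M hecke_algebra_simps(4) hecke_class_smult free_algebra_closed
          free_action_closed free_action_mult)
  qed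
  ultimately show ?thesis by (intro left_module.intro)
qed

lemma is_hecke_action_hecke_module: "is_hecke_action N B p (hecke_module B p)"
proof -
  have "hecke_scalar N c \<odot>\<^bsub>hecke_module B p\<^esub> v = scale c v"
    if "v \<in> carrier (hecke_module B p)" for c v
    using that unfolding hecke_scalar_def
    by (subst hecke_class_smult)
      (auto simp: free_action_single free_algebra_def hecke_module_def)
  moreover have "hecke_gen N i \<odot>\<^bsub>hecke_module B p\<^esub> basis_vec T = p i T"
    if "i \<in> {1..<N}" "T \<in> B" for i T
    using that unfolding hecke_gen_def
    by (subst hecke_class_smult)
      (auto simp: free_gen_def[of i] free_action_single free_algebra_def basis_vec_def[of T]
        linear_ext_eq_lin_comb)
  ultimately show ?thesis by (simp add: is_hecke_action_def)
qed

text \<open>If a word carries the generator to each basis vector, then a linear combination of these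
  words carries it to any given vector.\<close>

lemma cyclic_hecke_module:
  assumes g: "g \<in> B"
    and reach: "\<And>T. T \<in> B \<Longrightarrow>
      \<exists>is. set is \<subseteq> {1..<N} \<and> word_action p is (basis_vec g) = basis_vec T"
  shows "cyclic_module (hecke_algebra N) (hecke_module B p) (basis_vec g)"
proof -
  interpret left_module "hecke_algebra N" "hecke_module B p"
    by (rule left_module_hecke_module)
  have key: "\<exists>f\<in>carrier (free_algebra N). v = free_action p f (basis_vec g)"
    if v: "Poly_Mapping.keys v \<subseteq> B" for v
  proof -
    obtain w where w: "\<And>T. T \<in> B \<Longrightarrow> set (w T) \<subseteq> {1..<N}"
      "\<And>T. T \<in> B \<Longrightarrow> word_action p (w T) (basis_vec g) = basis_vec T"
      using reach by metis
    \<comment> \<open>Generalised from the support of \<open>v\<close> to any finite subset of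
      \<open>B\<close>, for the induction that adds one tableau at a time.\<close>
    have part: "\<exists>f\<in>carrier (free_algebra N).
        (\<Sum>T\<in>A. scale (Poly_Mapping.lookup v T) (basis_vec T)) = free_action p f (basis_vec g)"
      if "finite A" "A \<subseteq> B" for A
      using that
    proof (induction A rule: finite_induct)
      case empty
      have "0 \<in> carrier (free_algebra N)" by (simp add: free_algebra_def)
      then show ?case by (intro bexI[of _ 0]) simp_all
    next
      case (insert T A)
      then obtain f where f: "f \<in> carrier (free_algebra N)"
        "(\<Sum>T\<in>A. scale (Poly_Mapping.lookup v T) (basis_vec T)) = free_action p f (basis_vec g)"
        by auto
      \<comment> \<open>The chosen word for \<open>T\<close>, weighted with the coefficient of
        \<open>T\<close> in \<open>v\<close>.\<close>
      let ?f = "Poly_Mapping.single (Word (w T)) (Poly_Mapping.lookup v T)"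
      have "?f \<in> carrier (free_algebra N)" using w(1) insert.prems by (auto simp: free_algebra_def)
      then show ?case
        using f insert w(2)
        by (intro bexI[of _ "?f + f"])
          (simp_all add: free_action_add free_action_single free_algebra_closed)
    qed
    have "v = (\<Sum>T\<in>Poly_Mapping.keys v. scale (Poly_Mapping.lookup v T) (basis_vec T))"
      using lin_comb_basis_vec[of v] by (simp add: lin_comb_def)
    then show ?thesis using part[OF finite_keys v] by simp
  qed
  have gB: "Poly_Mapping.keys (basis_vec g) \<subseteq> B" using g by (simp add: basis_vec_def)
  then have gM: "basis_vec g \<in> carrier (hecke_module B p)" by (simp add: hecke_module_def)
  have "carrier (hecke_module B p)
      = {h \<odot>\<^bsub>hecke_module B p\<^esub> basis_vec g |h. h \<in> carrier (hecke_algebra N)}" (is "?L = ?R")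
  proof
    show "?L \<subseteq> ?R"
    proof
      fix v assume "v \<in> ?L"
      then have "Poly_Mapping.keys v \<subseteq> B" by (simp add: hecke_module_def)
      from key[OF this] obtain f
        where f: "f \<in> carrier (free_algebra N)" "v = free_action p f (basis_vec g)"
        by blast
      have "v = hecke_class N f \<odot>\<^bsub>hecke_module B p\<^esub> basis_vec g"
        by (simp only: hecke_class_smult[OF f(1) gB] f(2))
      moreover have "hecke_class N f \<in> carrier (hecke_algebra N)"
        using f(1) by (simp add: hecke_algebra_simps(1))
      ultimately show "v \<in> ?R" by blast
    qed
    show "?R \<subseteq> ?L" using smult_closed[OF _ gM] by blast
  qed
  then show ?thesis
    unfolding cyclic_module_def by (intro conjI gM left_module_hecke_module)
qed

end

section \<open>Standard fillings of skew diagrams\<close>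

lemma finite_diagram: "finite (diagram \<alpha>)"
  and card_diagram: "card (diagram \<alpha>) = sum_list \<alpha>"
proof -
  have "diagram \<alpha> = Sigma {..<length \<alpha>} (\<lambda>r. {..<\<alpha> ! r})"
    by (auto simp: diagram_def)
  then show "finite (diagram \<alpha>)" "card (diagram \<alpha>) = sum_list \<alpha>"
    by (simp_all add: sum_list_sum_nth atLeast0LessThan)
qed

lemma finite_skew [simp]: "finite (skew \<alpha> \<beta>)"
  by (simp add: skew_def finite_diagram)

lemma card_skew:
  assumes "contained \<beta> \<alpha>"
  shows "card (skew \<alpha> \<beta>) = sum_list \<alpha> - sum_list \<beta>"
proof -
  have "diagram \<beta> \<subseteq> diagram \<alpha>"
    using assms by (fastforce simp: diagram_def contained_def)
  then show ?thesis
    by (simp add: skew_def card_Diff_subset finite_diagram card_diagram)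
qed

definition blocked :: "cell \<Rightarrow> cell \<Rightarrow> bool" where
  "blocked x y \<longleftrightarrow> fst x = fst y \<or> snd x = 0 \<and> snd y = 0"

lemma blocked_sym: "blocked x y \<longleftrightarrow> blocked y x"
  by (auto simp: blocked_def)

context
  fixes \<alpha> \<beta> :: "nat list" and T :: tableau
  assumes T: "T \<in> SIT \<alpha> \<beta>"
begin

lemma SIT_bij: "bij_betw T (skew \<alpha> \<beta>) {1..sum_list \<alpha> - sum_list \<beta>}"
  and SIT_outside: "x \<notin> skew \<alpha> \<beta> \<Longrightarrow> T x = 0"
  and SIT_column: "(r, 0) \<in> skew \<alpha> \<beta> \<Longrightarrow> (r', 0) \<in> skew \<alpha> \<beta> \<Longrightarrow> r < r' \<Longrightarrow> T (r, 0) < T (r', 0)"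
  and SIT_row: "(r, c) \<in> skew \<alpha> \<beta> \<Longrightarrow> (r, c') \<in> skew \<alpha> \<beta> \<Longrightarrow> c < c' \<Longrightarrow> T (r, c) < T (r, c')"
  using T unfolding SIT_def by blast+

lemma SIT_inj: "x \<in> skew \<alpha> \<beta> \<Longrightarrow> y \<in> skew \<alpha> \<beta> \<Longrightarrow> T x = T y \<Longrightarrow> x = y"
  using SIT_bij by (auto simp: bij_betw_def dest: inj_onD)

lemma SIT_range: "x \<in> skew \<alpha> \<beta> \<Longrightarrow> T x \<in> {1..sum_list \<alpha> - sum_list \<beta>}"
  using SIT_bij by (auto simp: bij_betw_def)

lemma SIT_cell:
  assumes "k \<in> {1..sum_list \<alpha> - sum_list \<beta>}"
  obtains x where "x \<in> skew \<alpha> \<beta>" "T x = k"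
proof -
  have "k \<in> T ` skew \<alpha> \<beta>" using SIT_bij assms by (simp add: bij_betw_def)
  with that show thesis by (elim imageE) simp
qed

lemma SIT_row_less:
  assumes "x \<in> skew \<alpha> \<beta>" "y \<in> skew \<alpha> \<beta>" "fst x = fst y" "T x < T y"
  shows "snd x < snd y"
proof -
  have "snd x \<noteq> snd y" using assms by (metis less_irrefl prod_eqI)
  moreover have "\<not> snd y < snd x"
    using assms SIT_row[of "fst x" "snd y" "snd x"] by (cases x; cases y) auto
  ultimately show ?thesis by simp
qed

end

text \<open>The order conditions of \<open>SIT\<close> compare only blocked pairs, and the exchange
  reverses the order of a single pair, namely \<open>x\<close> and \<open>y\<close>.\<close>

lemma swap_in_SIT_iff:
  assumes T: "T \<in> SIT \<alpha> \<beta>" and i: "i \<in> {1..<sum_list \<alpha> - sum_list \<beta>}"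
    and xy: "x \<in> skew \<alpha> \<beta>" "y \<in> skew \<alpha> \<beta>" "T x = i" "T y = Suc i"
  shows "swap_entries i T \<in> SIT \<alpha> \<beta> \<longleftrightarrow> \<not> blocked x y"
proof
  assume swap: "\<not> blocked x y"
  \<comment> \<open>Transposing \<open>i\<close> and \<open>Suc i\<close> preserves every strict
    inequality between numbers except \<open>i < Suc i\<close>.\<close>
  have mono: "swap_entries i T a < swap_entries i T b"
    if "a \<in> skew \<alpha> \<beta>" "b \<in> skew \<alpha> \<beta>" "T a < T b" "blocked a b" for a b
  proof -
    have "\<not> (T a = i \<and> T b = Suc i)" using that swap xy SIT_inj[OF T] by metis
    with \<open>T a < T b\<close> show ?thesis by (auto simp: swap_entries_def transpose_def)
  qed
  have "bij_betw (transpose i (Suc i)) {1..sum_list \<alpha> - sum_list \<beta>} {1..sum_list \<alpha> - sum_list \<beta>}"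
    using i by (intro bij_betw_byWitness[where f' = "transpose i (Suc i)"]) (auto simp: transpose_def)
  then have "bij_betw (swap_entries i T) (skew \<alpha> \<beta>) {1..sum_list \<alpha> - sum_list \<beta>}"
    unfolding swap_entries_def using SIT_bij[OF T] by (rule bij_betw_trans[rotated])
  \<comment> \<open>The default entry 0 is fixed because \<open>i\<close> is at least 1.\<close>
  moreover have "swap_entries i T a = 0" if "a \<notin> skew \<alpha> \<beta>" for a
    using i SIT_outside[OF T that] by (simp add: swap_entries_def transpose_def)
  ultimately show "swap_entries i T \<in> SIT \<alpha> \<beta>"
    unfolding SIT_def mem_Collect_eq
  proof (intro conjI allI impI)
    fix r r' assume "(r, 0) \<in> skew \<alpha> \<beta> \<and> (r', 0) \<in> skew \<alpha> \<beta> \<and> r < r'"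
    then show "swap_entries i T (r, 0) < swap_entries i T (r', 0)"
      by (intro mono) (simp_all add: SIT_column[OF T] blocked_def)
  next
    fix r c c' assume "(r, c) \<in> skew \<alpha> \<beta> \<and> (r, c') \<in> skew \<alpha> \<beta> \<and> c < c'"
    then show "swap_entries i T (r, c) < swap_entries i T (r, c')"
      by (intro mono) (simp_all add: SIT_row[OF T] blocked_def)
  qed
next
  assume swap: "swap_entries i T \<in> SIT \<alpha> \<beta>"
  have val: "swap_entries i T x = Suc i" "swap_entries i T y = i"
    using xy by (simp_all add: swap_entries_def)
  show "\<not> blocked x y"
  proof
    assume "blocked x y"
    then consider "fst x = fst y" | "snd x = 0" "snd y = 0" by (auto simp: blocked_def)
    then show False
    proof cases
      case 1
      then have "snd x < snd y" using SIT_row_less[OF T] xy by simp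
      with SIT_row[OF swap, of "fst x" "snd x" "snd y"] val xy 1 show False
        by (cases x; cases y) simp
    next
      case 2
      have "fst x \<noteq> fst y" using 2 xy by (metis n_not_Suc_n prod_eqI)
      moreover have "\<not> fst y < fst x" using SIT_column[OF T, of "fst y" "fst x"] 2 xy
        by (cases x; cases y) auto
      ultimately have "fst x < fst y" by simp
      with SIT_column[OF swap, of "fst x" "fst y"] val xy 2 show False
        by (cases x; cases y) simp
    qed
  qed
qed

section \<open>The row superstandard tableau\<close>

lemma row_superstandard_mono:
  assumes "(r, c) \<in> skew \<alpha> \<beta>" "(r', c') \<in> skew \<alpha> \<beta>" "r < r' \<or> r = r' \<and> c < c'"
  shows "row_superstandard \<alpha> \<beta> (r, c) < row_superstandard \<alpha> \<beta> (r', c')"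
proof -
  let ?L = "\<lambda>r c. {(a, b). (a, b) \<in> skew \<alpha> \<beta> \<and> (a < r \<or> a = r \<and> b \<le> c)}"
  have "finite (?L r' c')" by (rule finite_subset[of _ "skew \<alpha> \<beta>"]) auto
  \<comment> \<open>The later cell counts itself but is not counted for the earlier one, so the
    inclusion is strict.\<close>
  moreover have "?L r c \<subseteq> ?L r' c'" "(r', c') \<in> ?L r' c'" "(r', c') \<notin> ?L r c"
    using assms by auto
  then have "?L r c \<subset> ?L r' c'" by blast
  ultimately show ?thesis
    using assms by (simp add: row_superstandard_def psubset_card_mono)
qed

text \<open>An injective map into an interval with as many elements as there are cells is onto.
  Growth along the reading order contains both the row and the column condition.\<close>

lemma row_superstandard_in_SIT:
  assumes "contained \<beta> \<alpha>"
  shows "row_superstandard \<alpha> \<beta> \<in> SIT \<alpha> \<beta>"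
proof -
  let ?f = "row_superstandard \<alpha> \<beta>"
  have inj: "inj_on ?f (skew \<alpha> \<beta>)"
  proof (rule inj_onI)
    fix x y assume xy: "x \<in> skew \<alpha> \<beta>" "y \<in> skew \<alpha> \<beta>" "?f x = ?f y"
    obtain r c r' c' where [simp]: "x = (r, c)" "y = (r', c')" by fastforce
    show "x = y"
      using xy row_superstandard_mono[of r c \<alpha> \<beta> r' c'] row_superstandard_mono[of r' c' \<alpha> \<beta> r c]
      by (cases rule: linorder_cases[of r r']; cases rule: linorder_cases[of c c']) auto
  qed
  have "?f x \<in> {1..card (skew \<alpha> \<beta>)}" if "x \<in> skew \<alpha> \<beta>" for x
  proof -
    obtain r c where [simp]: "x = (r, c)" by fastforce
    let ?L = "{(a, b). (a, b) \<in> skew \<alpha> \<beta> \<and> (a < r \<or> a = r \<and> b \<le> c)}"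
    have L: "?L \<subseteq> skew \<alpha> \<beta>" by auto
    have "0 < card ?L"
      unfolding card_gt_0_iff using that finite_subset[OF L] by auto
    moreover have "card ?L \<le> card (skew \<alpha> \<beta>)" using L by (intro card_mono) simp_all
    ultimately show ?thesis using that by (simp add: row_superstandard_def)
  qed
  then have "?f ` skew \<alpha> \<beta> = {1..card (skew \<alpha> \<beta>)}"
    using card_image[OF inj] by (intro card_subset_eq) auto
  with inj have "bij_betw ?f (skew \<alpha> \<beta>) {1..sum_list \<alpha> - sum_list \<beta>}"
    by (simp add: bij_betw_def card_skew[OF assms])
  then show ?thesis
    unfolding SIT_def mem_Collect_eq
  proof (intro conjI allI impI)
    show "?f x = 0" if "x \<notin> skew \<alpha> \<beta>" for x
      using that by (cases x) (simp add: row_superstandard_def)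
  qed (blast intro: row_superstandard_mono)+
qed

text \<open>If no step from an entry to the next goes down, rows weakly increase with the entries;
  with the row condition, entries then follow the reading order. Its contrapositive supplies the
  descent used to reach every tableau.\<close>

lemma row_superstandard_unique:
  assumes T: "T \<in> SIT \<alpha> \<beta>"
    and asc: "\<And>x y. x \<in> skew \<alpha> \<beta> \<Longrightarrow> y \<in> skew \<alpha> \<beta> \<Longrightarrow> T y = Suc (T x) \<Longrightarrow> fst x \<le> fst y"
  shows "T = row_superstandard \<alpha> \<beta>"
proof
  fix x
  \<comment> \<open>Induction on the difference \<open>k\<close> of the entries, through the cell
    that holds the entry just below \<open>T b\<close>.\<close>
  have rows: "fst a \<le> fst b"
    if "a \<in> skew \<alpha> \<beta>" "b \<in> skew \<alpha> \<beta>" "T b = T a + k" for a b k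
    using that
  proof (induction k arbitrary: b)
    case 0
    then show ?case using SIT_inj[OF T, of b a] by simp
  next
    case (Suc k)
    have "T a + k \<in> {1..sum_list \<alpha> - sum_list \<beta>}"
      using SIT_range[OF T Suc.prems(1)] SIT_range[OF T Suc.prems(2)] Suc.prems(3) by simp
    then obtain d where d: "d \<in> skew \<alpha> \<beta>" "T d = T a + k" by (rule SIT_cell[OF T])
    show ?case using Suc.IH[OF Suc.prems(1) d] asc[OF d(1) Suc.prems(2)] d(2) Suc.prems(3) by simp
  qed
  show "T x = row_superstandard \<alpha> \<beta> x"
  proof (cases "x \<in> skew \<alpha> \<beta>")
    case False
    then show ?thesis using SIT_outside[OF T False] by (cases x) (simp add: row_superstandard_def)
  next
    case True
    obtain r c where x: "x = (r, c)" by fastforce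
    have le: "T (a, b) \<le> T x \<longleftrightarrow> a < r \<or> a = r \<and> b \<le> c" if ab: "(a, b) \<in> skew \<alpha> \<beta>" for a b
    proof
      assume l: "T (a, b) \<le> T x"
      then have "a \<le> r" using rows[OF ab True, of "T x - T (a, b)"] x by simp
      moreover have "b \<le> c" if "a = r"
        using l SIT_row[OF T, of r c b] True ab that x by (meson leD leI)
      ultimately show "a < r \<or> a = r \<and> b \<le> c" by auto
    next
      assume l: "a < r \<or> a = r \<and> b \<le> c"
      show "T (a, b) \<le> T x"
      proof (rule ccontr)
        assume n: "\<not> T (a, b) \<le> T x"
        then have "r \<le> a" using rows[OF True ab, of "T (a, b) - T x"] x by simp
        with l have "a = r" "b \<le> c" by auto
        then show False using n SIT_row[OF T, of r b c] True ab x by (cases "b = c") auto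
      qed
    qed
    \<comment> \<open>All values from 1 to \<open>T x\<close> occur as entries, so
      \<open>T x\<close> counts the cells with entry at most \<open>T x\<close>.\<close>
    have "T ` {y \<in> skew \<alpha> \<beta>. T y \<le> T x} = {1..T x}"
    proof
      show "T ` {y \<in> skew \<alpha> \<beta>. T y \<le> T x} \<subseteq> {1..T x}"
        using SIT_range[OF T] by auto
      show "{1..T x} \<subseteq> T ` {y \<in> skew \<alpha> \<beta>. T y \<le> T x}"
      proof
        fix k assume k: "k \<in> {1..T x}"
        then have "k \<in> {1..sum_list \<alpha> - sum_list \<beta>}" using SIT_range[OF T True] by simp
        then obtain d where "d \<in> skew \<alpha> \<beta>" "T d = k" by (rule SIT_cell[OF T])
        with k show "k \<in> T ` {y \<in> skew \<alpha> \<beta>. T y \<le> T x}" by force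
      qed
    qed
    moreover have "inj_on T {y \<in> skew \<alpha> \<beta>. T y \<le> T x}"
      using SIT_inj[OF T] by (auto intro: inj_onI)
    ultimately have "card {y \<in> skew \<alpha> \<beta>. T y \<le> T x} = T x"
      using card_image by fastforce
    moreover have "{y \<in> skew \<alpha> \<beta>. T y \<le> T x}
        = {(a, b). (a, b) \<in> skew \<alpha> \<beta> \<and> (a < r \<or> a = r \<and> b \<le> c)}"
      using le by auto
    ultimately show ?thesis using True x by (simp add: row_superstandard_def)
  qed
qed

section \<open>The operators on tableaux\<close>

lemma swap_entries_apply [simp]:
  "T x = i \<Longrightarrow> swap_entries i T x = Suc i"
  "T x = Suc i \<Longrightarrow> swap_entries i T x = i"
  "T x \<noteq> i \<Longrightarrow> T x \<noteq> Suc i \<Longrightarrow> swap_entries i T x = T x"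
  by (simp_all add: swap_entries_def)

lemma swap_entries_twice [simp]: "swap_entries i (swap_entries i T) = T"
  by (simp add: swap_entries_def fun_eq_iff)

text \<open>\<open>M u v w\<close> stands for the arrangement with three consecutive entries in the cells \<open>u\<close>, \<open>v\<close>,
  \<open>w\<close>. Either side of the relation sorts the three cells into decreasing order, and gives 0 exactly
  if one of the pairs to be exchanged is blocked.\<close>

lemma braid_sorting:
  assumes L1: "\<And>u v w. Q u v w \<Longrightarrow>
      L1 (M u v w) = (if lt v u then M u v w else if bl u v then z else M v u w)"
    and L2: "\<And>u v w. Q u v w \<Longrightarrow>
      L2 (M u v w) = (if lt w v then M u v w else if bl v w then z else M u w v)"
    and Q1: "\<And>u v w. Q u v w \<Longrightarrow> \<not> bl u v \<Longrightarrow> Q v u w"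
    and Q2: "\<And>u v w. Q u v w \<Longrightarrow> \<not> bl v w \<Longrightarrow> Q u w v"
    and z: "L1 z = z" "L2 z = z"
    and bl: "\<And>u v. bl u v \<longleftrightarrow> bl v u"
    and asym: "\<And>u v. lt u v \<Longrightarrow> \<not> lt v u"
    and trans: "\<And>u v w. lt u v \<Longrightarrow> lt v w \<Longrightarrow> lt u w"
    and total: "\<And>u v. u \<noteq> v \<Longrightarrow> lt u v \<or> lt v u"
    and Q: "Q a b c" and distinct: "a \<noteq> b" "a \<noteq> c" "b \<noteq> c"
  shows "L1 (L2 (L1 (M a b c))) = L2 (L1 (L2 (M a b c)))"
proof -
  \<comment> \<open>Each pair of distinct cells is decided by one truth value, so three of them
    describe the order of \<open>a\<close>, \<open>b\<close>, \<open>c\<close>.\<close>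
  have order: "lt b a \<longleftrightarrow> \<not> lt a b" "lt c a \<longleftrightarrow> \<not> lt a c" "lt c b \<longleftrightarrow> \<not> lt b c"
    using asym total distinct by blast+
  \<comment> \<open>Excludes the two cyclic patterns among the eight, which leaves the six linear
    orders.\<close>
  have cycle: "lt a b \<Longrightarrow> lt b c \<Longrightarrow> lt a c" "\<not> lt a b \<Longrightarrow> \<not> lt b c \<Longrightarrow> \<not> lt a c"
    using trans order by blast+
  have bl': "bl b a \<longleftrightarrow> bl a b" "bl c a \<longleftrightarrow> bl a c" "bl c b \<longleftrightarrow> bl b c"
    using bl by blast+
  \<comment> \<open>All further arrangements that either side can pass through; each arises by
    exchanges of unblocked pairs only.\<close>
  have reach: "\<not> bl a b \<Longrightarrow> Q b a c" "\<not> bl b c \<Longrightarrow> Q a c b"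
    "\<not> bl a b \<Longrightarrow> \<not> bl a c \<Longrightarrow> Q b c a" "\<not> bl b c \<Longrightarrow> \<not> bl a c \<Longrightarrow> Q c a b"
    "\<not> bl a b \<Longrightarrow> \<not> bl a c \<Longrightarrow> \<not> bl b c \<Longrightarrow> Q c b a"
    using Q Q1 Q2 by blast+
  show ?thesis
    using cycle
    by (cases "lt a b"; cases "lt b c"; cases "lt a c"; cases "bl a b"; cases "bl b c"; cases "bl a c";
      simp add: L1 L2 reach Q z order bl')
qed

text \<open>Covers both actions at once: \<open>lt\<close> is the cell order in which a pair of
  consecutive entries is a descent. It must refine the order of the rows, which the generation
  argument uses; within a row the direction is left to the instance.\<close>

locale descent_order =
  fixes \<alpha> \<beta> :: "nat list" and lt :: "cell \<Rightarrow> cell \<Rightarrow> bool" and Des :: "tableau \<Rightarrow> nat set"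
  assumes contained: "contained \<beta> \<alpha>"
    and lt_asym: "lt x y \<Longrightarrow> \<not> lt y x"
    and lt_trans: "lt x y \<Longrightarrow> lt y z \<Longrightarrow> lt x z"
    and lt_total: "x \<noteq> y \<Longrightarrow> lt x y \<or> lt y x"
    and lt_rows: "fst x < fst y \<Longrightarrow> lt x y"
    and Des_iff: "T \<in> SIT \<alpha> \<beta> \<Longrightarrow> x \<in> skew \<alpha> \<beta> \<Longrightarrow> y \<in> skew \<alpha> \<beta> \<Longrightarrow> T y = Suc (T x) \<Longrightarrow>
      T x \<in> Des T \<longleftrightarrow> lt x y"
begin

abbreviation N :: nat where "N \<equiv> sum_list \<alpha> - sum_list \<beta>"
abbreviation B :: "tableau set" where "B \<equiv> SIT \<alpha> \<beta>"
abbreviation p :: "nat \<Rightarrow> tableau \<Rightarrow> tableau_vec" where "p \<equiv> hecke_pi Des B"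

text \<open>Turns the operator into a decision about the two cells \<open>x\<close> and
  \<open>y\<close> alone. This is what makes different steps comparable.\<close>

lemma pi_eq:
  assumes "i \<in> {1..<N}" "T \<in> B" "x \<in> skew \<alpha> \<beta>" "y \<in> skew \<alpha> \<beta>" "T x = i" "T y = Suc i"
  shows "p i T = (if lt y x then basis_vec T else if blocked x y then 0
    else basis_vec (swap_entries i T))"
proof -
  have "x \<noteq> y" using assms by auto
  then show ?thesis
    using assms Des_iff[of T x y] swap_in_SIT_iff[of T \<alpha> \<beta> i x y] lt_total[of x y] lt_asym[of x y]
    by (auto simp: hecke_pi_def)
qed

lemma adjacent_cells:
  assumes "i \<in> {1..<N}" "T \<in> B"
  obtains x y where "x \<in> skew \<alpha> \<beta>" "y \<in> skew \<alpha> \<beta>" "T x = i" "T y = Suc i" "x \<noteq> y"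
proof -
  have "i \<in> {1..N}" "Suc i \<in> {1..N}" using assms(1) by auto
  then obtain x y where xy: "x \<in> skew \<alpha> \<beta>" "T x = i" "y \<in> skew \<alpha> \<beta>" "T y = Suc i"
    by (metis SIT_cell[OF assms(2)])
  then have "x \<noteq> y" by auto
  then show ?thesis using that xy by blast
qed

lemma pi_idem:
  assumes "i \<in> {1..<N}" "T \<in> B"
  shows "linear_ext (p i) (p i T) = p i T"
proof -
  obtain x y where xy: "x \<in> skew \<alpha> \<beta>" "y \<in> skew \<alpha> \<beta>" "T x = i" "T y = Suc i" "x \<noteq> y"
    using adjacent_cells[OF assms] .
  note eq = pi_eq[OF assms xy(1-4)]
  show ?thesis
  proof (cases "lt y x \<or> blocked x y")
    case True
    then show ?thesis using eq by auto
  next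
    case False
    then have "swap_entries i T \<in> B" using swap_in_SIT_iff[OF assms(2,1) xy(1-4)] by simp
    \<comment> \<open>After the exchange \<open>y\<close> holds \<open>i\<close> and
      \<open>x\<close> holds \<open>Suc i\<close>. Now the pair is decreasing, and the second
      application fixes it.\<close>
    from pi_eq[OF assms(1) this xy(2,1)] show ?thesis
      using False xy eq lt_total[of x y] by simp
  qed
qed

text \<open>The four entries involved are distinct, so neither exchange moves the entries that the
  other compares, and the two decisions are independent.\<close>

lemma pi_far_commute:
  assumes i: "i \<in> {1..<N}" and j: "j \<in> {1..<N}" and ij: "i + 2 \<le> j" and T: "T \<in> B"
  shows "linear_ext (p i) (p j T) = linear_ext (p j) (p i T)"
proof -
  obtain x y where xy: "x \<in> skew \<alpha> \<beta>" "y \<in> skew \<alpha> \<beta>" "T x = i" "T y = Suc i"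
    using adjacent_cells[OF i T] .
  obtain u v where uv: "u \<in> skew \<alpha> \<beta>" "v \<in> skew \<alpha> \<beta>" "T u = j" "T v = Suc j"
    using adjacent_cells[OF j T] .
  let ?Ti = "swap_entries i T" and ?Tj = "swap_entries j T"
  have vals: "?Ti u = j" "?Ti v = Suc j" "?Tj x = i" "?Tj y = Suc i"
    using xy uv ij by simp_all
  have comm: "swap_entries i ?Tj = swap_entries j ?Ti"
    using ij by (auto simp: swap_entries_def fun_eq_iff transpose_def)
  have "\<not> blocked x y \<Longrightarrow> p j ?Ti = (if lt v u then basis_vec ?Ti else if blocked u v then 0
      else basis_vec (swap_entries j ?Ti))"
    using swap_in_SIT_iff[OF T i xy] pi_eq[OF j _ uv(1,2) vals(1,2)] by blast
  moreover have "\<not> blocked u v \<Longrightarrow> p i ?Tj = (if lt y x then basis_vec ?Tj else if blocked x y then 0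
      else basis_vec (swap_entries j ?Ti))"
    using swap_in_SIT_iff[OF T j uv] pi_eq[OF i _ xy(1,2) vals(3,4)] by (simp only: comm) blast
  ultimately show ?thesis
    using pi_eq[OF i T xy] pi_eq[OF j T uv] by (simp split: if_splits)
qed

text \<open>An instance of \<open>braid_sorting\<close>, with \<open>M u v w\<close> the basis
  vector of \<open>T\<close> after its three consecutive entries are redistributed over the cells
  \<open>u\<close>, \<open>v\<close>, \<open>w\<close>.\<close>

lemma pi_braid:
  assumes i: "i \<in> {1..<N}" "Suc i \<in> {1..<N}" and T: "T \<in> B"
  shows "linear_ext (p i) (linear_ext (p (Suc i)) (p i T))
    = linear_ext (p (Suc i)) (linear_ext (p i) (p (Suc i) T))"
proof -
  obtain a b where ab: "a \<in> skew \<alpha> \<beta>" "b \<in> skew \<alpha> \<beta>" "T a = i" "T b = Suc i"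
    using adjacent_cells[OF i(1) T] .
  obtain b' c where "b' \<in> skew \<alpha> \<beta>" "T b' = Suc i" and c: "c \<in> skew \<alpha> \<beta>" "T c = Suc (Suc i)"
    using adjacent_cells[OF i(2) T] .
  have ne: "a \<noteq> b" "a \<noteq> c" "b \<noteq> c" using ab c by auto
  \<comment> \<open>Ensures that exchanges touch only the three cells. Cells outside the skew
    diagram carry 0, which is below \<open>i\<close>.\<close>
  have other: "T d \<notin> {i, Suc i, Suc (Suc i)}" if "d \<notin> {a, b, c}" for d
  proof (cases "d \<in> skew \<alpha> \<beta>")
    case True
    then show ?thesis using that SIT_inj[OF T] ab c by (metis insertCI insertE singletonD)
  next
    case False
    then show ?thesis using SIT_outside[OF T False] i by simp
  qed
  define E where "E u v w = T(u := i, v := Suc i, w := Suc (Suc i))" for u v w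
  \<comment> \<open>The invariant: the arrangement is again a standard filling and uses the three
    cells once each.\<close>
  define Q where "Q u v w \<longleftrightarrow> E u v w \<in> B \<and> {u, v, w} = {a, b, c} \<and> u \<noteq> v \<and> u \<noteq> w \<and> v \<noteq> w"
    for u v w
  have E_apply: "E u v w u = i" "E u v w v = Suc i" "E u v w w = Suc (Suc i)"
    and E_swap: "swap_entries i (E u v w) = E v u w"
      "swap_entries (Suc i) (E u v w) = E u w v"
    and E_cells: "u \<in> skew \<alpha> \<beta>" "v \<in> skew \<alpha> \<beta>" "w \<in> skew \<alpha> \<beta>"
    and E_in: "E u v w \<in> B"
    if "Q u v w" for u v w
  proof -
    from that have uvw: "{u, v, w} = {a, b, c}" "u \<noteq> v" "u \<noteq> w" "v \<noteq> w"
      and "E u v w \<in> B" by (auto simp: Q_def)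
    then show "E u v w \<in> B" by simp
    show "E u v w u = i" "E u v w v = Suc i" "E u v w w = Suc (Suc i)"
      using uvw by (auto simp: E_def)
    have "{u, v, w} \<subseteq> skew \<alpha> \<beta>" unfolding uvw(1) using ab c by simp
    then show "u \<in> skew \<alpha> \<beta>" "v \<in> skew \<alpha> \<beta>" "w \<in> skew \<alpha> \<beta>" by simp_all
    have o: "T d \<notin> {i, Suc i, Suc (Suc i)}" if "d \<notin> {u, v, w}" for d
      using other that uvw(1) by simp
    show "swap_entries i (E u v w) = E v u w" "swap_entries (Suc i) (E u v w) = E u w v"
      using uvw(2-4) o by (auto simp: E_def swap_entries_def fun_eq_iff transpose_def)
  qed
  have E_T: "E a b c = T" using ab c by (auto simp: E_def)
  have "linear_ext (p i) (linear_ext (p (Suc i)) (linear_ext (p i) (basis_vec (E a b c))))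
      = linear_ext (p (Suc i)) (linear_ext (p i) (linear_ext (p (Suc i)) (basis_vec (E a b c))))"
  proof (rule braid_sorting[where Q = Q and lt = lt and bl = blocked and z = 0])
    fix u v w assume Q: "Q u v w"
    show "linear_ext (p i) (basis_vec (E u v w)) = (if lt v u then basis_vec (E u v w)
        else if blocked u v then 0 else basis_vec (E v u w))"
      using pi_eq[OF i(1) E_in[OF Q] E_cells(1,2)[OF Q] E_apply(1,2)[OF Q]]
      by (simp add: E_swap[OF Q])
    show "linear_ext (p (Suc i)) (basis_vec (E u v w)) = (if lt w v then basis_vec (E u v w)
        else if blocked v w then 0 else basis_vec (E u w v))"
      using pi_eq[OF i(2) E_in[OF Q] E_cells(2,3)[OF Q] E_apply(2,3)[OF Q]]
      by (simp add: E_swap[OF Q])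
    show "Q v u w" if "\<not> blocked u v"
      using that Q swap_in_SIT_iff[OF E_in[OF Q] i(1) E_cells(1,2)[OF Q] E_apply(1,2)[OF Q]]
      by (auto simp: E_swap[OF Q] Q_def)
    show "Q u w v" if "\<not> blocked v w"
      using that Q swap_in_SIT_iff[OF E_in[OF Q] i(2) E_cells(2,3)[OF Q] E_apply(2,3)[OF Q]]
      by (auto simp: E_swap[OF Q] Q_def)
  next
    show "Q a b c" using T E_T ne by (simp add: Q_def)
  qed (rule linear_ext_zero blocked_sym ne | erule lt_asym | erule (1) lt_trans | erule lt_total)+
  then show ?thesis by (simp add: E_T)
qed

sublocale hecke_rep N B p
proof
  fix i T assume iT: "i \<in> {1..<N}" "T \<in> B"
  obtain x y where "x \<in> skew \<alpha> \<beta>" "y \<in> skew \<alpha> \<beta>" "T x = i" "T y = Suc i"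
    using adjacent_cells[OF iT] .
  with iT pi_eq[of i T x y] swap_in_SIT_iff[of T \<alpha> \<beta> i x y]
  show "Poly_Mapping.keys (p i T) \<subseteq> B"
    by (auto simp: basis_vec_def split: if_splits)
qed (rule pi_idem pi_braid pi_far_commute; assumption)+

text \<open>Exchanging \<open>i\<close> with an \<open>Suc i\<close> in a lower row raises the sum of the products of row and
  entry, and so lowers the measure of the induction.\<close>

lemma reach_from_row_superstandard:
  assumes "T \<in> B"
  shows "\<exists>is. set is \<subseteq> {1..<N} \<and>
    word_action p is (basis_vec (row_superstandard \<alpha> \<beta>)) = basis_vec T"
  using assms
proof (induction "\<Sum>x\<in>skew \<alpha> \<beta>. fst x * (N - T x)" arbitrary: T rule: less_induct)
  case less
  show ?case
  proof (cases "T = row_superstandard \<alpha> \<beta>")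
    case True
    then show ?thesis by (intro exI[of _ "[]"]) simp
  next
    case False
    \<comment> \<open>By \<open>row_superstandard_unique\<close>, some entry has its successor in a
      strictly lower row.\<close>
    then obtain x y where xy: "x \<in> skew \<alpha> \<beta>" "y \<in> skew \<alpha> \<beta>" "T y = Suc (T x)" "fst y < fst x"
      using row_superstandard_unique[OF less.prems] by (metis not_le)
    define i where "i = T x"
    have i: "i \<in> {1..<N}"
      using SIT_range[OF less.prems xy(1)] SIT_range[OF less.prems xy(2)] xy(3) by (simp add: i_def)
    \<comment> \<open>The preimage of \<open>T\<close>: in \<open>S\<close> the lower cell
      \<open>y\<close> holds the smaller entry, so \<open>p i\<close> exchanges the two
      back.\<close>
    define S where "S = swap_entries i T"
    have Sxy: "S y = i" "S x = Suc i" using xy by (simp_all add: S_def i_def)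
    \<comment> \<open>The rows differ, and in the first column the lower cell \<open>y\<close> could
      not hold the larger entry.\<close>
    have unblocked: "\<not> blocked x y"
    proof
      assume "blocked x y"
      then have "snd x = 0" "snd y = 0" using xy(4) by (auto simp: blocked_def)
      then show False
        using xy SIT_column[OF less.prems, of "fst y" "fst x"] by (cases x; cases y) simp
    qed
    then have S: "S \<in> B"
      using swap_in_SIT_iff[OF less.prems i xy(1,2)] xy(3) by (simp add: S_def i_def)
    have "(\<Sum>z\<in>skew \<alpha> \<beta>. fst z * (N - S z)) < (\<Sum>z\<in>skew \<alpha> \<beta>. fst z * (N - T z))"
    proof -
      have split: "(\<Sum>z\<in>skew \<alpha> \<beta>. f z) = f x + (f y + (\<Sum>z\<in>skew \<alpha> \<beta> - {x} - {y}. f z))"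
        for f :: "cell \<Rightarrow> nat"
        using xy sum.remove[of "skew \<alpha> \<beta>" x f] sum.remove[of "skew \<alpha> \<beta> - {x}" y f] by auto
      have rest: "S z = T z" if "z \<in> skew \<alpha> \<beta> - {x} - {y}" for z
      proof -
        have "T z \<noteq> T x" "T z \<noteq> T y" using that xy SIT_inj[OF less.prems] by blast+
        then show ?thesis using xy(3) by (simp add: S_def i_def)
      qed
      have "fst x * (N - Suc i) + fst y * (N - i) < fst x * (N - i) + fst y * (N - Suc i)"
      proof -
        \<comment> \<open>Here \<open>i < N\<close> keeps the truncated subtraction exact; the
          measure drops by \<open>fst x - fst y\<close>.\<close>
        have "N - i = Suc (N - Suc i)" using i by auto
        then show ?thesis using xy(4) by simp
      qed
      then show ?thesis
        unfolding split using Sxy xy(3) rest by (simp add: i_def)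
    qed
    from less.hyps[OF this S] obtain "is" where "is": "set is \<subseteq> {1..<N}"
      "word_action p is (basis_vec (row_superstandard \<alpha> \<beta>)) = basis_vec S" by blast
    have "p i S = basis_vec T"
      using pi_eq[OF i S xy(2,1) Sxy] lt_asym[OF lt_rows[OF xy(4)]] unblocked
      by (simp add: blocked_sym[of y x] S_def)
    \<comment> \<open>The new letter goes to the front of the word because the leftmost letter acts
      last.\<close>
    then show ?thesis using "is" i by (intro exI[of _ "i # is"]) simp
  qed
qed

lemma hecke_module_cyclic:
  "is_hecke_action N B p (hecke_module B p) \<and>
    cyclic_module (hecke_algebra N) (hecke_module B p) (basis_vec (row_superstandard \<alpha> \<beta>))"
  using is_hecke_action_hecke_module
    cyclic_hecke_module[OF row_superstandard_in_SIT[OF contained] reach_from_row_superstandard]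
  by blast

end

section \<open>The two descent sets as instances\<close>

lemma adjacent_cells_iff:
  assumes T: "T \<in> SIT \<alpha> \<beta>"
    and xy: "x \<in> skew \<alpha> \<beta>" "y \<in> skew \<alpha> \<beta>" "T y = Suc (T x)"
  shows "(\<exists>a\<in>skew \<alpha> \<beta>. \<exists>b\<in>skew \<alpha> \<beta>. T a = T x \<and> T b = Suc (T x) \<and> P a b) \<longleftrightarrow> P x y"
proof
  assume "\<exists>a\<in>skew \<alpha> \<beta>. \<exists>b\<in>skew \<alpha> \<beta>. T a = T x \<and> T b = Suc (T x) \<and> P a b"
  then obtain a b where ab: "a \<in> skew \<alpha> \<beta>" "b \<in> skew \<alpha> \<beta>" "T a = T x" "T b = T y" "P a b"
    using xy(3) by auto
  \<comment> \<open>Entries determine cells, so the existential quantifiers in the descent sets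
    collapse to the given pair.\<close>
  have "a = x" "b = y" using SIT_inj[OF T] ab xy by blast+
  with ab show "P x y" by simp
next
  assume "P x y"
  with xy show "\<exists>a\<in>skew \<alpha> \<beta>. \<exists>b\<in>skew \<alpha> \<beta>. T a = T x \<and> T b = Suc (T x) \<and> P a b"
    by (intro bexI[of _ x] bexI[of _ y]) simp_all
qed

text \<open>The two actions differ only in whether cells of the same row count as sorted: along a row,
  entries increase to the right, so a left neighbour is placed after its right one for
  \<^const>\<open>Des_S\<close> and before it for \<^const>\<open>Des_A\<close>.\<close>

lemma descent_order_S:
  assumes "contained \<beta> \<alpha>"
  shows "descent_order \<alpha> \<beta> (\<lambda>x y. fst x < fst y \<or> fst x = fst y \<and> snd y < snd x) (Des_S \<alpha> \<beta>)"
proof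
  fix T x y assume T: "T \<in> SIT \<alpha> \<beta>"
    and xy: "x \<in> skew \<alpha> \<beta>" "y \<in> skew \<alpha> \<beta>" "T y = Suc (T x)"
  have "T x \<in> Des_S \<alpha> \<beta> T \<longleftrightarrow> fst x < fst y"
    using adjacent_cells_iff[OF T xy, of "\<lambda>a b. fst a < fst b"] by (simp add: Des_S_def)
  \<comment> \<open>In a common row the smaller entry lies to the left, so the second disjunct is
    false here.\<close>
  then show "T x \<in> Des_S \<alpha> \<beta> T \<longleftrightarrow> fst x < fst y \<or> fst x = fst y \<and> snd y < snd x"
    using SIT_row_less[OF T xy(1,2)] xy(3) by auto
qed (use assms in \<open>auto simp: prod_eq_iff\<close>)

lemma descent_order_A:
  assumes "contained \<beta> \<alpha>"
  shows "descent_order \<alpha> \<beta> (\<lambda>x y. fst x < fst y \<or> fst x = fst y \<and> snd x < snd y) (Des_A \<alpha> \<beta>)"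
proof
  fix T x y assume T: "T \<in> SIT \<alpha> \<beta>"
    and xy: "x \<in> skew \<alpha> \<beta>" "y \<in> skew \<alpha> \<beta>" "T y = Suc (T x)"
  have "T x \<in> Des_A \<alpha> \<beta> T \<longleftrightarrow> fst x \<le> fst y"
    using adjacent_cells_iff[OF T xy, of "\<lambda>a b. fst a \<le> fst b"] by (simp add: Des_A_def)
  \<comment> \<open>In a common row the smaller entry lies to the left, so the second disjunct
    reduces to equality of rows.\<close>
  then show "T x \<in> Des_A \<alpha> \<beta> T \<longleftrightarrow> fst x < fst y \<or> fst x = fst y \<and> snd x < snd y"
    using SIT_row_less[OF T xy(1,2)] xy(3) by auto
qed (use assms in \<open>auto simp: prod_eq_iff\<close>)

theorem theorem6p11:
  fixes \<alpha> \<beta> :: "nat list" and n m :: nat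
  assumes "composition \<alpha> n" and "composition \<beta> m" and "contained \<beta> \<alpha>"
  shows "is_hecke_action (n - m) (SIT \<alpha> \<beta>) (pi_S \<alpha> \<beta>) (W_module \<alpha> \<beta>) \<and>
         cyclic_module (hecke_algebra (n - m)) (W_module \<alpha> \<beta>)
           (basis_vec (row_superstandard \<alpha> \<beta>)) \<and>
         is_hecke_action (n - m) (SIT \<alpha> \<beta>) (pi_A \<alpha> \<beta>) (A_module \<alpha> \<beta>) \<and>
         cyclic_module (hecke_algebra (n - m)) (A_module \<alpha> \<beta>)
           (basis_vec (row_superstandard \<alpha> \<beta>))"
proof -
  have "n = sum_list \<alpha>" "m = sum_list \<beta>" using assms(1,2) by (simp_all add: composition_def)
  then show ?thesis
    using descent_order.hecke_module_cyclic[OF descent_order_S[OF assms(3)]]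
      descent_order.hecke_module_cyclic[OF descent_order_A[OF assms(3)]]
    by (simp add: W_module_def A_module_def pi_S_def pi_A_def)
qed

end
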